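(* If a $B_1$-algebra $A$ is weakly noetherian, then it has the Evans property.
   Context: A $B_1$-algebra (characteristic one semiring) is a commutative semiring $A$ with $0$ (neutral for addition and absorbing for multiplication) and $1$, such that $1+1=1$ (hence $x+x=x$ for all $x\in A$). An ideal of $A$ is a subset containing $0$, closed under addition, and closed under multiplication by elements of $A$. The saturation of an ideal $I$ is $\overline{I}=\{x\in A\mid \exists y\in I,\ x+y=y\}$, which is an ideal; $I$ is saturated if $I=\overline{I}$. An ideal $\mathcal{P}$ is prime if $\mathcal{P}\neq A$ and $xy\in\mathcal{P}$ implies $x\in\mathcal{P}$ or $y\in\mathcal{P}$. $A$ is weakly noetherian if every ascending chain of saturated ideals of $A$ is ultimately stationary. For an ideal $I$ of $A$, let $\mathcal{D}_A(I)=\{x\in A\mid \exists y\notin I,\ xy\in I\}$. $A$ has the Evans property if, for each saturated ideal $I$ of $A$, $\mathcal{D}_A(I)$ is a finite union of saturated prime ideals of $A$ (the empty union being $\emptyset$). *)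

theory Defs
  imports Main
begin

(* comm_semiring_1 is avoided since it contains zero_neq_one: the trivial algebra is allowed. *)
class b1_algebra = comm_semiring_0 + comm_monoid_mult +
  assumes one_plus_one: "1 + 1 = 1"

definition is_ideal :: "'a::b1_algebra set \<Rightarrow> bool" where
  "is_ideal I \<longleftrightarrow> 0 \<in> I \<and> (\<forall>x\<in>I. \<forall>y\<in>I. x + y \<in> I) \<and> (\<forall>a. \<forall>x\<in>I. a * x \<in> I)"

definition saturation :: "'a::b1_algebra set \<Rightarrow> 'a set" where
  "saturation I = {x. \<exists>y\<in>I. x + y = y}"

definition saturated_ideal :: "'a::b1_algebra set \<Rightarrow> bool" where
  "saturated_ideal I \<longleftrightarrow> is_ideal I \<and> I = saturation I"

definition prime_ideal :: "'a::b1_algebra set \<Rightarrow> bool" where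
  "prime_ideal P \<longleftrightarrow>
     is_ideal P \<and> P \<noteq> UNIV \<and> (\<forall>x y. x * y \<in> P \<longrightarrow> x \<in> P \<or> y \<in> P)"

definition weakly_noetherian :: "'a::b1_algebra itself \<Rightarrow> bool" where
  "weakly_noetherian (_ :: 'a itself) \<longleftrightarrow>
     (\<forall>I :: nat \<Rightarrow> 'a set.
        (\<forall>n. saturated_ideal (I n)) \<and> (\<forall>n. I n \<subseteq> I (Suc n)) \<longrightarrow>
        (\<exists>N. \<forall>n\<ge>N. I n = I N))"

(* D_A(I): the zero divisors modulo I. *)
definition zero_divisors_mod :: "'a::b1_algebra set \<Rightarrow> 'a set" where
  "zero_divisors_mod I = {x. \<exists>y. y \<notin> I \<and> x * y \<in> I}"

definition evans_property :: "'a::b1_algebra itself \<Rightarrow> bool" where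
  "evans_property (_ :: 'a itself) \<longleftrightarrow>
     (\<forall>I :: 'a set. saturated_ideal I \<longrightarrow>
        (\<exists>\<P>. finite \<P> \<and> (\<forall>P\<in>\<P>. saturated_ideal P \<and> prime_ideal P) \<and>
             zero_divisors_mod I = \<Union>\<P>))"

lemma add_idem: "x + x = (x::'a::b1_algebra)"
  using distrib_left[of x 1 1] by (simp add: one_plus_one)

lemma is_ideal_saturation:
  fixes I :: "'a::b1_algebra set"
  assumes "is_ideal I"
  shows "is_ideal (saturation I)"
proof -
  have "0 \<in> saturation I"
    using assms by (auto simp: is_ideal_def saturation_def)
  moreover have "x + y \<in> saturation I" if "x \<in> saturation I" "y \<in> saturation I" for x y
  proof -
    from that obtain u v where "u \<in> I" "x + u = u" "v \<in> I" "y + v = v"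
      by (auto simp: saturation_def)
    moreover have "(x + y) + (u + v) = (x + u) + (y + v)"
      by (simp add: ac_simps)
    ultimately show ?thesis
      using assms unfolding is_ideal_def saturation_def by (auto intro!: bexI[of _ "u + v"])
  qed
  moreover have "a * x \<in> saturation I" if "x \<in> saturation I" for a x
  proof -
    from that obtain u where "u \<in> I" "x + u = u"
      by (auto simp: saturation_def)
    moreover have "a * x + a * u = a * (x + u)"
      by (simp add: distrib_left)
    ultimately show ?thesis
      using assms unfolding is_ideal_def saturation_def by (auto intro!: bexI[of _ "a * u"])
  qed
  ultimately show ?thesis
    by (simp add: is_ideal_def)
qed

end

theory Submission imports Defs begin

text \<open>
  \<open>\<D>(I)\<close> is the union of the saturated ideals \<open>(I : y)\<close>, \<open>y \<notin> I\<close>; by the chain condition each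
  lies in a maximal one, and the maximal ones are prime. If there were infinitely many, say
  \<open>P n = (I : y n)\<close>, the ascending chain of saturated ideals
  \<open>J n = (I : P 0 \<inter> \<dots> \<inter> P n)\<close> would become stationary at some \<open>N\<close>. As \<open>y (N + 1) \<in> J (N + 1) = J N\<close>,
  the intersection \<open>P 0 \<inter> \<dots> \<inter> P N\<close> is contained in the prime ideal \<open>P (N + 1)\<close>, hence so
  is some \<open>P i\<close> with \<open>i \<le> N\<close>, against the maximality of \<open>P i\<close>.
\<close>

text \<open>The colon ideal (I : S). \<open>S\<close> is an arbitrary subset because both singletons
  (for the primes) and finite intersections of primes (for the ascending chain) occur.\<close>

definition ideal_quotient :: "'a::b1_algebra set \<Rightarrow> 'a set \<Rightarrow> 'a set" where
  "ideal_quotient I S = {x. \<forall>s\<in>S. x * s \<in> I}"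

text \<open>Multiplying x + y = y by s gives x s + y s = y s, so saturation can be tested in I, one
  s at a time.\<close>

lemma saturated_ideal_quotient:
  assumes "saturated_ideal I"
  shows "saturated_ideal (ideal_quotient I S)"
proof -
  have I: "is_ideal I" and sat: "\<And>x y. y \<in> I \<Longrightarrow> x + y = y \<Longrightarrow> x \<in> I"
    using assms by (auto simp: saturated_ideal_def saturation_def)
  have "is_ideal (ideal_quotient I S)"
    using I by (simp add: is_ideal_def ideal_quotient_def distrib_right mult.assoc)
  moreover have "x \<in> ideal_quotient I S" if "y \<in> ideal_quotient I S" "x + y = y" for x y
    unfolding ideal_quotient_def
  proof (intro CollectI ballI)
    fix s assume "s \<in> S"
    then have "y * s \<in> I" using that(1) by (simp add: ideal_quotient_def)
    moreover have "x * s + y * s = y * s" using that(2) by (metis distrib_right)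
    ultimately show "x * s \<in> I" by (rule sat)
  qed
  \<comment> \<open>Idempotence x + x = x puts every set inside its saturation; the other inclusion
    was just shown.\<close>
  ultimately show ?thesis
    by (auto simp: saturated_ideal_def saturation_def intro: add_idem)
qed

lemma zero_divisors_mod_eq_Union:
  "zero_divisors_mod I = (\<Union>y\<in>-I. ideal_quotient I {y})"
  by (auto simp: zero_divisors_mod_def ideal_quotient_def)

lemma weakly_noetherian_chain:
  fixes J :: "nat \<Rightarrow> 'a::b1_algebra set"
  assumes "weakly_noetherian TYPE('a)"
    and "\<And>n. saturated_ideal (J n)" "\<And>n. J n \<subseteq> J (Suc n)"
  obtains N where "J (Suc N) = J N"
proof -
  obtain N where "\<forall>n\<ge>N. J n = J N"
    using assms unfolding weakly_noetherian_def by blast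
  then have "J (Suc N) = J N"
    using le_SucI[OF order_refl] by blast
  then show thesis by (rule that)
qed

text \<open>If no member of \<open>F\<close> above \<open>K\<close> were maximal, dependent choice
  would give a strictly ascending chain of saturated ideals.\<close>

lemma weakly_noetherian_maximal:
  fixes K :: "'a::b1_algebra set"
  assumes "weakly_noetherian TYPE('a)"
    and F: "\<And>L. L \<in> F \<Longrightarrow> saturated_ideal L" and "K \<in> F"
  obtains M where "M \<in> F" "K \<subseteq> M" "\<And>L. L \<in> F \<Longrightarrow> M \<subseteq> L \<Longrightarrow> L = M"
proof (rule ccontr)
  note maximal = that
  assume "\<not> thesis"
  then have step: "\<exists>L. L \<in> F \<and> K \<subseteq> L \<and> M \<subset> L" if "M \<in> F \<and> K \<subseteq> M" for M
    using that maximal[of M] by blast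
  have "\<exists>J. \<forall>n::nat. (J n \<in> F \<and> K \<subseteq> J n) \<and> J n \<subset> J (Suc n)"
  proof (rule dependent_nat_choice)
    show "\<exists>L. L \<in> F \<and> K \<subseteq> L"
      using \<open>K \<in> F\<close> by blast
    show "\<exists>L. (L \<in> F \<and> K \<subseteq> L) \<and> M \<subset> L" if "M \<in> F \<and> K \<subseteq> M" for M and n :: nat
      using step[OF that] by blast
  qed
  then obtain J :: "nat \<Rightarrow> 'a set" where J: "\<And>n. J n \<in> F" "\<And>n. J n \<subset> J (Suc n)"
    by blast
  have "saturated_ideal (J n)" "J n \<subseteq> J (Suc n)" for n
    using F J by auto
  then obtain N where "J (Suc N) = J N"
    using weakly_noetherian_chain[OF assms(1)] by blast
  then show False
    using J(2)[of N] by auto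
qed

text \<open>If a b y lies in I but b y does not, then (I : b y) contains (I : y), so both agree by
  maximality, and a lies in the former.\<close>

lemma prime_ideal_maximal_quotient:
  assumes "saturated_ideal I" "y \<notin> I"
    and max: "\<And>z. z \<notin> I \<Longrightarrow> ideal_quotient I {y} \<subseteq> ideal_quotient I {z}
                \<Longrightarrow> ideal_quotient I {z} = ideal_quotient I {y}"
  shows "prime_ideal (ideal_quotient I {y})"
  unfolding prime_ideal_def
proof (intro conjI allI impI)
  show "is_ideal (ideal_quotient I {y})"
    using saturated_ideal_quotient[OF assms(1)] by (simp add: saturated_ideal_def)
  have "1 \<notin> ideal_quotient I {y}"
    using assms(2) by (simp add: ideal_quotient_def)
  then show "ideal_quotient I {y} \<noteq> UNIV" by blast
  fix a b assume ab: "a * b \<in> ideal_quotient I {y}"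
  show "a \<in> ideal_quotient I {y} \<or> b \<in> ideal_quotient I {y}"
  proof (cases "b * y \<in> I")
    case True
    then show ?thesis by (simp add: ideal_quotient_def)
  next
    case False
    have "x * (b * y) \<in> I" if "x * y \<in> I" for x
      using that assms(1) unfolding saturated_ideal_def is_ideal_def
      by (metis mult.left_commute)
    then have "ideal_quotient I {b * y} = ideal_quotient I {y}"
      by (intro max False) (auto simp: ideal_quotient_def)
    moreover have "a \<in> ideal_quotient I {b * y}"
      using ab by (simp add: ideal_quotient_def mult.assoc)
    ultimately show ?thesis by simp
  qed
qed

lemma prime_ideal_prod:
  assumes "prime_ideal P" "finite A" "(\<Prod>i\<in>A. f i) \<in> P"
  shows "\<exists>i\<in>A. f i \<in> P"
  using assms(2,3)
proof (induction A rule: finite_induct)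
  case empty
  \<comment> \<open>The empty product is 1, and 1 in P would force P to be everything.\<close>
  then have "a * 1 \<in> P" for a
    using assms(1) by (auto simp: prime_ideal_def is_ideal_def simp del: mult_1_right)
  then show ?case
    using assms(1) by (auto simp: prime_ideal_def)
next
  case (insert i A)
  then show ?case
    using assms(1) by (auto simp: prime_ideal_def)
qed

text \<open>Otherwise pick \<open>t i\<close> in \<open>Q i\<close> outside \<open>P\<close> for
  each i: the product of all \<open>t i\<close> lies in every \<open>Q i\<close>, but not in the
  prime \<open>P\<close>.\<close>

lemma prime_ideal_Inter_subset:
  assumes "prime_ideal P" "finite A" "\<And>i. i \<in> A \<Longrightarrow> is_ideal (Q i)" "(\<Inter>i\<in>A. Q i) \<subseteq> P"
  shows "\<exists>i\<in>A. Q i \<subseteq> P"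
proof (rule ccontr)
  assume "\<not> ?thesis"
  then have "\<forall>i\<in>A. \<exists>x. x \<in> Q i \<and> x \<notin> P"
    by blast
  then obtain t where t: "\<forall>i\<in>A. t i \<in> Q i \<and> t i \<notin> P"
    by (rule bchoice[THEN exE])
  have "(\<Prod>j\<in>A. t j) \<in> Q i" if "i \<in> A" for i
  proof -
    have "(\<Prod>j\<in>A. t j) = (\<Prod>j\<in>A - {i}. t j) * t i"
      using prod.remove[OF \<open>finite A\<close> that, of t] by (simp add: mult.commute)
    then show ?thesis
      using t assms(3)[OF that] that by (simp add: is_ideal_def)
  qed
  then show False
    using prime_ideal_prod[OF assms(1,2), of t] assms(4) t by blast
qed

lemma finite_maximal_quotients:
  fixes I :: "'a::b1_algebra set"
  assumes "weakly_noetherian TYPE('a)" and I: "saturated_ideal I"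
    and quot: "\<And>P. P \<in> \<M> \<Longrightarrow> \<exists>y. P = ideal_quotient I {y}"
    and prime: "\<And>P. P \<in> \<M> \<Longrightarrow> prime_ideal P"
    and antichain: "\<And>P Q. P \<in> \<M> \<Longrightarrow> Q \<in> \<M> \<Longrightarrow> P \<subseteq> Q \<Longrightarrow> P = Q"
  shows "finite \<M>"
proof (rule ccontr)
  assume "infinite \<M>"
  then obtain P :: "nat \<Rightarrow> 'a set" where "inj P" and P: "\<And>n. P n \<in> \<M>"
    using infinite_countable_subset[of \<M>] by blast
  have "\<forall>n. \<exists>z. P n = ideal_quotient I {z}"
    using quot P by blast
  then obtain y where y: "\<And>n. P n = ideal_quotient I {y n}"
    using choice[of "\<lambda>n z. P n = ideal_quotient I {z}"] by blast
  define J where "J n = ideal_quotient I (\<Inter>i\<le>n. P i)" for n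
  \<comment> \<open>The intersections shrink with n, so fewer conditions are imposed and the
    quotients grow.\<close>
  have "J n \<subseteq> J (Suc n)" for n
    by (auto simp: J_def ideal_quotient_def)
  moreover have "saturated_ideal (J n)" for n
    unfolding J_def using I by (rule saturated_ideal_quotient)
  ultimately obtain N where "J (Suc N) = J N"
    using weakly_noetherian_chain[OF assms(1)] by blast
  moreover have "y (Suc N) \<in> J (Suc N)"
    by (auto simp: J_def y ideal_quotient_def mult.commute)
  ultimately have "y (Suc N) \<in> J N" by simp
  \<comment> \<open>Each x in the intersection satisfies x * \<open>y (Suc N)\<close> \<in> I, which
    is membership in \<open>P (Suc N)\<close>.\<close>
  then have "(\<Inter>i\<in>{..N}. P i) \<subseteq> P (Suc N)"
    unfolding y[of "Suc N"] by (auto simp: J_def ideal_quotient_def mult.commute)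
  moreover have "is_ideal (P i)" for i
    using prime[OF P] by (simp add: prime_ideal_def)
  ultimately obtain i where "i \<le> N" "P i \<subseteq> P (Suc N)"
    using prime_ideal_Inter_subset[OF prime[OF P], of "{..N}" P "Suc N"] by auto
  then have "P i = P (Suc N)"
    using antichain P by blast
  with \<open>inj P\<close> \<open>i \<le> N\<close> show False
    by (auto dest: injD)
qed

theorem theorem7p4:
  assumes "weakly_noetherian TYPE('a::b1_algebra)"
  shows "evans_property TYPE('a)"
  unfolding evans_property_def
proof (intro allI impI)
  fix I :: "'a set" assume I: "saturated_ideal I"
  define F where "F = (\<lambda>y. ideal_quotient I {y}) ` (-I)"
  define \<M> where "\<M> = {M \<in> F. \<forall>L\<in>F. M \<subseteq> L \<longrightarrow> L = M}"
  have sat: "saturated_ideal L" if "L \<in> F" for L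
    using that saturated_ideal_quotient[OF I] by (auto simp: F_def)
  have prime: "prime_ideal M" if M: "M \<in> \<M>" for M
  proof -
    obtain y where y: "y \<notin> I" "M = ideal_quotient I {y}"
      using M by (auto simp: \<M>_def F_def)
    show ?thesis
      unfolding y(2) using M y
      by (intro prime_ideal_maximal_quotient[OF I]) (auto simp: \<M>_def F_def)
  qed
  have "finite \<M>"
    \<comment> \<open>Members of \<open>\<M>\<close> are pairwise incomparable, since each is
      maximal in \<open>F\<close>.\<close>
    by (rule finite_maximal_quotients[OF assms I _ prime]) (auto simp: \<M>_def F_def)
  moreover have "zero_divisors_mod I = \<Union>\<M>"
  proof
    show "\<Union>\<M> \<subseteq> zero_divisors_mod I"
      by (auto simp: zero_divisors_mod_eq_Union \<M>_def F_def)
    have "K \<subseteq> \<Union>\<M>" if K: "K \<in> F" for K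
    proof -
      obtain M where "M \<in> F" "K \<subseteq> M" "\<And>L. L \<in> F \<Longrightarrow> M \<subseteq> L \<Longrightarrow> L = M"
        using weakly_noetherian_maximal[OF assms sat K] by blast
      then show ?thesis by (auto simp: \<M>_def)
    qed
    then show "zero_divisors_mod I \<subseteq> \<Union>\<M>"
      unfolding zero_divisors_mod_eq_Union F_def by blast
  qed
  ultimately show "\<exists>\<P>. finite \<P> \<and> (\<forall>P\<in>\<P>. saturated_ideal P \<and> prime_ideal P)
      \<and> zero_divisors_mod I = \<Union>\<P>"
    using sat prime by (intro exI[of _ \<M>]) (auto simp: \<M>_def)
qed

end
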